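(* The space of finite persistence diagrams with the bottleneck distance, i.e. the metric subspace of $(\mathrm{Dgm}_\infty,w_\infty)$ consisting of the classes of persistence diagrams with finite index set, does not admit a coarse embedding into a Hilbert space.
   Context: Let $\mathbb{R}^2_< = \{(x,y)\in\mathbb{R}^2 : x<y\}$ with metric $d_\infty(a,b)=\|a-b\|_\infty=\max(|a_x-b_x|,|a_y-b_y|)$, and let $\Delta$ be the diagonal in $\mathbb{R}^2$; for $a\in\mathbb{R}^2_<$, $d_\infty(a,\Delta)=\inf_{t\in\Delta}\|a-t\|_\infty=(a_y-a_x)/2$. A persistence diagram is a function $D:I\to\mathbb{R}^2_<$ with $I$ a countable (possibly finite or empty) set; it is finite if $I$ is finite; $\emptyset$ denotes the diagram with empty index set. A partial matching between $D_1:I_1\to\mathbb{R}^2_<$ and $D_2:I_2\to\mathbb{R}^2_<$ is a triple $(I_1',I_2',f)$ with $I_1'\subseteq I_1$, $I_2'\subseteq I_2$ and $f:I_1'\to I_2'$ a bijection. Its $\infty$-cost is $$\mathrm{cost}_\infty(f)=\max\Big\{\sup_{i\in I_1'}d_\infty(D_1(i),D_2(f(i))),\ \sup_{i\in I_1\setminus I_1'}d_\infty(D_1(i),\Delta),\ \sup_{i\in I_2\setminus I_2'}d_\infty(D_2(i),\Delta)\Big\}\in[0,\infty]$$ (suprema over empty sets are $0$). Put $\tilde w_\infty(D_1,D_2)=\inf\{\mathrm{cost}_\infty(f)\}$ over all partial matchings between $D_1$ and $D_2$. The space $(\mathrm{Dgm}_\infty,w_\infty)$ is the set of persistence diagrams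 $D$ with $\tilde w_\infty(D,\emptyset)<\infty$, modulo the relation $D_1\sim D_2$ iff $\tilde w_\infty(D_1,D_2)=0$, with the induced metric $w_\infty$ (the bottleneck distance). A map $f:(X,d)\to(Y,d')$ is a coarse embedding if there exist non-decreasing functions $\rho_-,\rho_+:[0,\infty)\to[0,\infty)$ such that $\rho_-(d(x,y))\le d'(f(x),f(y))\le\rho_+(d(x,y))$ for all $x,y\in X$ and $\lim_{t\to\infty}\rho_-(t)=\infty$. A Hilbert space carries the metric induced by its norm. *)

theory Defs
  imports "HOL-Analysis.Analysis"
begin

section \<open>The half-plane with the maximum metric\<close>

definition half_plane :: "(real \<times> real) set" where
  "half_plane = {(x, y). x < y}"

definition diagonal :: "(real \<times> real) set" where
  "diagonal = {(x, y). x = y}"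

text \<open>The library instance of \<open>dist\<close> on \<open>real \<times> real\<close> is Euclidean, hence a separate constant.\<close>

definition dinf :: "real \<times> real \<Rightarrow> real \<times> real \<Rightarrow> real" where
  "dinf a b = max \<bar>fst a - fst b\<bar> \<bar>snd a - snd b\<bar>"

definition dinf_diag :: "real \<times> real \<Rightarrow> real" where
  "dinf_diag a = (INF t\<in>diagonal. dinf a t)"

section \<open>Persistence diagrams and matchings\<close>

text \<open>A diagram is an index set together with a function on it; the function is
  \<open>extensional\<close>, so two diagrams are equal iff they are equal as functions.\<close>

type_synonym 'i diagram = "'i set \<times> ('i \<Rightarrow> real \<times> real)"

definition persistence_diagram :: "'i diagram \<Rightarrow> bool" where
  "persistence_diagram D \<longleftrightarrow> countable (fst D) \<and> snd D \<in> fst D \<rightarrow>\<^sub>E half_plane"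

definition empty_diagram :: "'i diagram" where
  "empty_diagram = ({}, \<lambda>_. undefined)"

definition partial_matching ::
  "'i diagram \<Rightarrow> 'j diagram \<Rightarrow> 'i set \<times> 'j set \<times> ('i \<Rightarrow> 'j) \<Rightarrow> bool" where
  "partial_matching D E = (\<lambda>(A, B, f). A \<subseteq> fst D \<and> B \<subseteq> fst E \<and> bij_betw f A B)"

text \<open>In \<open>ennreal\<close> the supremum of the empty set is \<open>0\<close>.\<close>

definition matching_cost ::
  "'i diagram \<Rightarrow> 'j diagram \<Rightarrow> 'i set \<times> 'j set \<times> ('i \<Rightarrow> 'j) \<Rightarrow> ennreal" where
  "matching_cost D E = (\<lambda>(A, B, f).
     max (SUP i\<in>A. ennreal (dinf (snd D i) (snd E (f i))))
       (max (SUP i\<in>fst D - A. ennreal (dinf_diag (snd D i)))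
            (SUP j\<in>fst E - B. ennreal (dinf_diag (snd E j)))))"

definition pre_bottleneck :: "'i diagram \<Rightarrow> 'j diagram \<Rightarrow> ennreal" where
  "pre_bottleneck D E = (INF m\<in>{m. partial_matching D E m}. matching_cost D E m)"

section \<open>The space of persistence diagrams\<close>

text \<open>Index sets are taken inside \<open>nat\<close>. This loses nothing: by \<open>nat_reindexing\<close> below, every
  diagram with a countable index set is at distance \<open>0\<close> from one indexed by a set of
  natural numbers (finite if the original index set is).\<close>

definition Dgm_carrier :: "nat diagram set" where
  "Dgm_carrier = {D. persistence_diagram D \<and>
     pre_bottleneck D (empty_diagram :: nat diagram) < \<infinity>}"

definition Dgm_rel :: "(nat diagram \<times> nat diagram) set" where
  "Dgm_rel = {(D, E). D \<in> Dgm_carrier \<and> E \<in> Dgm_carrier \<and> pre_bottleneck D E = 0}"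

definition Dgm :: "nat diagram set set" where
  "Dgm = Dgm_carrier // Dgm_rel"

text \<open>The value does not depend on the chosen representatives; see \<open>bottleneck_class\<close>.\<close>

definition bottleneck :: "nat diagram set \<Rightarrow> nat diagram set \<Rightarrow> real" where
  "bottleneck X Y = enn2real (pre_bottleneck (SOME D. D \<in> X) (SOME E. E \<in> Y))"

definition finite_Dgm :: "nat diagram set set" where
  "finite_Dgm = {X \<in> Dgm. \<exists>D\<in>X. finite (fst D)}"

section \<open>Coarse embeddings\<close>

definition coarse_embedding ::
  "'a set \<Rightarrow> ('a \<Rightarrow> 'a \<Rightarrow> real) \<Rightarrow> 'b set \<Rightarrow> ('b \<Rightarrow> 'b \<Rightarrow> real) \<Rightarrow> ('a \<Rightarrow> 'b) \<Rightarrow> bool" where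
  "coarse_embedding X d Y d' f \<longleftrightarrow> f \<in> X \<rightarrow> Y \<and>
     (\<exists>\<rho>l \<rho>u :: real \<Rightarrow> real.
        \<rho>l \<in> {0..} \<rightarrow> {0..} \<and> \<rho>u \<in> {0..} \<rightarrow> {0..} \<and>
        mono_on {0..} \<rho>l \<and> mono_on {0..} \<rho>u \<and>
        (\<forall>x\<in>X. \<forall>y\<in>X. \<rho>l (d x y) \<le> d' (f x) (f y) \<and> d' (f x) (f y) \<le> \<rho>u (d x y)) \<and>
        filterlim \<rho>l at_top at_top)"

section \<open>The bottleneck distance is a metric\<close>

lemma dinf_commute: "dinf a b = dinf b a"
  by (auto simp: dinf_def abs_minus_commute)

lemma dinf_nonneg: "0 \<le> dinf a b"
  by (auto simp: dinf_def)

lemma dinf_triangle: "dinf a c \<le> dinf a b + dinf b c"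
  by (auto simp: dinf_def)

lemma dinf_diag_eq: "dinf_diag a = \<bar>snd a - fst a\<bar> / 2"
  unfolding dinf_diag_def
proof (rule cInf_eq_minimum)
  let ?m = "(fst a + snd a) / 2"
  have "dinf a (?m, ?m) = \<bar>snd a - fst a\<bar> / 2"
    unfolding dinf_def by (auto simp: field_simps abs_if max_def)
  then show "\<bar>snd a - fst a\<bar> / 2 \<in> dinf a ` diagonal"
    by (intro image_eqI[of _ _ "(?m, ?m)"]) (auto simp: diagonal_def)
next
  fix x assume "x \<in> dinf a ` diagonal"
  then obtain b where "x = max \<bar>fst a - b\<bar> \<bar>snd a - b\<bar>"
    by (auto simp: diagonal_def dinf_def)
  then have "\<bar>fst a - b\<bar> \<le> x" "\<bar>snd a - b\<bar> \<le> x" by simp_all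
  then show "\<bar>snd a - fst a\<bar> / 2 \<le> x"
    unfolding abs_le_iff by (simp add: abs_if field_simps)
qed

lemma dinf_diag_half_plane: "a \<in> half_plane \<Longrightarrow> dinf_diag a = (snd a - fst a) / 2"
  by (auto simp: dinf_diag_eq half_plane_def)

lemma dinf_diag_nonneg: "0 \<le> dinf_diag a"
  by (simp add: dinf_diag_eq)

lemma dinf_diag_triangle: "dinf_diag a \<le> dinf a b + dinf_diag b"
proof -
  have "\<bar>fst a - fst b\<bar> \<le> dinf a b" "\<bar>snd a - snd b\<bar> \<le> dinf a b"
    by (simp_all add: dinf_def)
  then show ?thesis unfolding dinf_diag_eq abs_le_iff by (simp add: abs_if field_simps)
qed

lemma matching_cost_le_iff:
  "matching_cost D E (A, B, f) \<le> c \<longleftrightarrow>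
     (\<forall>i\<in>A. ennreal (dinf (snd D i) (snd E (f i))) \<le> c) \<and>
     (\<forall>i\<in>fst D - A. ennreal (dinf_diag (snd D i)) \<le> c) \<and>
     (\<forall>j\<in>fst E - B. ennreal (dinf_diag (snd E j)) \<le> c)"
  unfolding matching_cost_def by (simp add: SUP_le_iff)

lemma pre_bottleneck_le:
  "partial_matching D E m \<Longrightarrow> matching_cost D E m \<le> c \<Longrightarrow> pre_bottleneck D E \<le> c"
  unfolding pre_bottleneck_def by (rule INF_lower2) auto

lemma pre_bottleneck_less:
  assumes "pre_bottleneck D E < c"
  obtains A B f where "A \<subseteq> fst D" "B \<subseteq> fst E" "bij_betw f A B" "matching_cost D E (A, B, f) < c"
  using assms unfolding pre_bottleneck_def INF_less_iff
  by (auto simp: partial_matching_def)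

lemma pre_bottleneck_refl: "pre_bottleneck D D = 0"
proof -
  have "matching_cost D D (fst D, fst D, id) \<le> 0"
    unfolding matching_cost_le_iff by (simp add: dinf_def)
  then have "pre_bottleneck D D \<le> 0"
    by (rule pre_bottleneck_le[rotated]) (simp add: partial_matching_def)
  then show ?thesis by simp
qed

lemma pre_bottleneck_commute_le: "pre_bottleneck D E \<le> pre_bottleneck E D"
proof (rule dense_ge)
  fix c assume "pre_bottleneck E D < c"
  then obtain A B f where m: "A \<subseteq> fst E" "B \<subseteq> fst D" "bij_betw f A B"
    "matching_cost E D (A, B, f) < c"
    by (rule pre_bottleneck_less)
  let ?g = "the_inv_into A f"
  have g: "bij_betw ?g B A" using m(3) by (rule bij_betw_the_inv_into)
  have fg: "f (?g j) = j" if "j \<in> B" for j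
    using m(3) that by (rule f_the_inv_into_f_bij_betw)
  have gA: "?g j \<in> A" if "j \<in> B" for j
    using g that by (rule bij_betw_apply)
  have le: "matching_cost E D (A, B, f) \<le> c" using m(4) by simp
  show "pre_bottleneck D E \<le> c"
  proof (rule pre_bottleneck_le[of _ _ "(B, A, ?g)"])
    show "partial_matching D E (B, A, ?g)"
      using m g by (simp add: partial_matching_def)
    show "matching_cost D E (B, A, ?g) \<le> c"
      unfolding matching_cost_le_iff
    proof (intro conjI ballI)
      fix j assume "j \<in> B"
      then show "ennreal (dinf (snd D j) (snd E (?g j))) \<le> c"
        using bspec[OF conjunct1[OF le[unfolded matching_cost_le_iff]] gA[of j]] fg[of j]
        by (simp add: dinf_commute)
    qed (use le in \<open>simp_all add: matching_cost_le_iff\<close>)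
  qed
qed

lemma pre_bottleneck_commute: "pre_bottleneck D E = pre_bottleneck E D"
  by (intro antisym pre_bottleneck_commute_le)

lemma pre_bottleneck_triangle: "pre_bottleneck D F \<le> pre_bottleneck D E + pre_bottleneck E F"
proof (rule ennreal_le_epsilon)
  fix e :: real
  assume fin: "pre_bottleneck D E + pre_bottleneck E F < top" and e: "0 < e"
  let ?u = "pre_bottleneck D E + ennreal (e / 2)"
  let ?v = "pre_bottleneck E F + ennreal (e / 2)"
  have "pre_bottleneck D E < ?u" "pre_bottleneck E F < ?v"
    using fin e ennreal_add_left_cancel_less[of _ 0 "ennreal (e / 2)"] by auto
  note lt = this
  from lt(1) obtain A B f where m1: "A \<subseteq> fst D" "B \<subseteq> fst E" "bij_betw f A B"
    "matching_cost D E (A, B, f) < ?u" by (rule pre_bottleneck_less)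
  from lt(2) obtain A' C g where m2: "A' \<subseteq> fst E" "C \<subseteq> fst F" "bij_betw g A' C"
    "matching_cost E F (A', C, g) < ?v" by (rule pre_bottleneck_less)
  note le1 = less_imp_le[OF m1(4), unfolded matching_cost_le_iff]
  note le2 = less_imp_le[OF m2(4), unfolded matching_cost_le_iff]
  have add: "ennreal z \<le> ?u + ?v"
    if "z \<le> x + y" "ennreal x \<le> ?u" "ennreal y \<le> ?v" "0 \<le> x" "0 \<le> y" for x y z
  proof -
    have "ennreal z \<le> ennreal x + ennreal y"
      using that by (metis ennreal_leI ennreal_plus)
    also have "\<dots> \<le> ?u + ?v" using that by (intro add_mono)
    finally show ?thesis .
  qed
  define X where "X = {i \<in> A. f i \<in> A'}"
  have "bij_betw (g \<circ> f) X ((g \<circ> f) ` X)"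
    using m1(3) m2(3) by (auto simp: bij_betw_def inj_on_def X_def)
  have "pre_bottleneck D F \<le> ?u + ?v"
  proof (rule pre_bottleneck_le[of _ _ "(X, (g \<circ> f) ` X, g \<circ> f)"])
    show "partial_matching D F (X, (g \<circ> f) ` X, g \<circ> f)"
      using m1 m2 \<open>bij_betw (g \<circ> f) X _\<close>
      by (auto simp: partial_matching_def X_def bij_betw_def)
    show "matching_cost D F (X, (g \<circ> f) ` X, g \<circ> f) \<le> ?u + ?v"
      unfolding matching_cost_le_iff
    proof (intro conjI ballI)
      fix i assume "i \<in> X"
      then show "ennreal (dinf (snd D i) (snd F ((g \<circ> f) i))) \<le> ?u + ?v"
        using le1 le2
        by (intro add[OF dinf_triangle[of _ _ "snd E (f i)"]]) (auto simp: X_def dinf_nonneg)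
    next
      fix i assume i: "i \<in> fst D - X"
      show "ennreal (dinf_diag (snd D i)) \<le> ?u + ?v"
      proof (cases "i \<in> A")
        case True
        with i m1(2,3) have "f i \<in> fst E - A'" by (auto simp: X_def bij_betw_def)
        then show ?thesis using True le1 le2
          by (intro add[OF dinf_diag_triangle[of _ "snd E (f i)"]])
             (auto simp: dinf_nonneg dinf_diag_nonneg)
      next
        case False
        with i le1 show ?thesis
          by (intro add[of _ "dinf_diag (snd D i)" 0]) (auto simp: dinf_diag_nonneg)
      qed
    next
      fix k assume k: "k \<in> fst F - (g \<circ> f) ` X"
      show "ennreal (dinf_diag (snd F k)) \<le> ?u + ?v"
      proof (cases "k \<in> C")
        case True
        with m2(3) obtain j where j: "j \<in> A'" "k = g j" by (auto simp: bij_betw_def)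
        have "j \<notin> B"
        proof
          assume "j \<in> B"
          with m1(3) obtain i where "i \<in> A" "j = f i" by (auto simp: bij_betw_def)
          with j k show False by (auto simp: X_def)
        qed
        with j m2(1) have j': "j \<in> fst E - B" by auto
        have "dinf_diag (snd F k) \<le> dinf_diag (snd E j) + dinf (snd E j) (snd F k)"
          using dinf_diag_triangle[of "snd F k" "snd E j"] by (simp add: dinf_commute)
        then show ?thesis using j j' le1 le2
          by (intro add[of _ "dinf_diag (snd E j)" "dinf (snd E j) (snd F k)"])
             (auto simp: dinf_nonneg dinf_diag_nonneg)
      next
        case False
        with k le2 show ?thesis
          by (intro add[of _ 0 "dinf_diag (snd F k)"]) (auto simp: dinf_diag_nonneg)
      qed
    qed
  qed
  also have "?u + ?v = (pre_bottleneck D E + pre_bottleneck E F) + (ennreal (e/2) + ennreal (e/2))"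
    by (simp add: ac_simps)
  also have "ennreal (e/2) + ennreal (e/2) = ennreal e"
    using e by (simp flip: ennreal_plus)
  finally show "pre_bottleneck D F \<le> pre_bottleneck D E + pre_bottleneck E F + ennreal e" .
qed

lemma nat_reindexing:
  fixes D :: "'i diagram"
  assumes "persistence_diagram D"
  obtains E :: "nat diagram" where "persistence_diagram E" "pre_bottleneck D E = 0"
    "finite (fst E) \<longleftrightarrow> finite (fst D)"
proof -
  let ?h = "to_nat_on (fst D)"
  let ?J = "?h ` fst D"
  have inj: "inj_on ?h (fst D)" using assms by (auto simp: persistence_diagram_def)
  let ?E = "(?J, restrict (snd D \<circ> the_inv_into (fst D) ?h) ?J)"
  show thesis
  proof (rule that)
    show "persistence_diagram ?E"
      using assms by (auto simp: persistence_diagram_def the_inv_into_f_f[OF inj])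
    have "matching_cost D ?E (fst D, ?J, ?h) \<le> 0"
      unfolding matching_cost_le_iff by (simp add: the_inv_into_f_f[OF inj] dinf_def)
    then have "pre_bottleneck D ?E \<le> 0"
      by (rule pre_bottleneck_le[rotated])
         (simp add: partial_matching_def inj_on_imp_bij_betw[OF inj])
    then show "pre_bottleneck D ?E = 0" by simp
    show "finite (fst ?E) \<longleftrightarrow> finite (fst D)" using inj by (simp add: finite_image_iff)
  qed
qed

lemma pre_bottleneck_finite:
  assumes "D \<in> Dgm_carrier" "E \<in> Dgm_carrier"
  shows "pre_bottleneck D E < \<infinity>"
proof -
  have "pre_bottleneck D E \<le> pre_bottleneck D (empty_diagram :: nat diagram)
      + pre_bottleneck E (empty_diagram :: nat diagram)"
    using pre_bottleneck_triangle pre_bottleneck_commute by metis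
  also have "\<dots> < \<infinity>" using assms by (simp add: Dgm_carrier_def ennreal_add_less_top)
  finally show ?thesis .
qed

lemma finite_diagram_in_Dgm_carrier:
  assumes "persistence_diagram D" "finite (fst D)"
  shows "D \<in> Dgm_carrier"
proof -
  let ?c = "SUP i\<in>fst D. ennreal (dinf_diag (snd D i))"
  have "pre_bottleneck D (empty_diagram :: nat diagram) \<le> ?c"
    by (rule pre_bottleneck_le[of _ _ "({}, {}, id)"])
       (auto simp: partial_matching_def matching_cost_le_iff empty_diagram_def intro: SUP_upper)
  also have "?c \<le> ennreal (\<Sum>i\<in>fst D. dinf_diag (snd D i))"
    by (intro SUP_least ennreal_leI member_le_sum) (use assms dinf_diag_nonneg in auto)
  also have "\<dots> < \<infinity>" by simp
  finally show ?thesis using assms by (simp add: Dgm_carrier_def)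
qed

lemma equiv_Dgm_rel: "equiv Dgm_carrier Dgm_rel"
proof (rule equivI)
  show "Dgm_rel \<subseteq> Dgm_carrier \<times> Dgm_carrier" by (auto simp: Dgm_rel_def)
  show "refl_on Dgm_carrier Dgm_rel"
    by (auto simp: refl_on_def Dgm_rel_def pre_bottleneck_refl)
  show "sym Dgm_rel"
    unfolding sym_def Dgm_rel_def mem_Collect_eq case_prod_conv
    by (metis pre_bottleneck_commute)
  show "trans Dgm_rel"
  proof (rule transI)
    fix D E F assume *: "(D, E) \<in> Dgm_rel" "(E, F) \<in> Dgm_rel"
    then have "pre_bottleneck D F \<le> 0 + 0"
      using pre_bottleneck_triangle[of D F E] by (simp add: Dgm_rel_def)
    with * show "(D, F) \<in> Dgm_rel" by (simp add: Dgm_rel_def)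
  qed
qed

lemma pre_bottleneck_cong:
  assumes "(D, D') \<in> Dgm_rel" "(E, E') \<in> Dgm_rel"
  shows "pre_bottleneck D E = pre_bottleneck D' E'"
proof -
  have le: "pre_bottleneck D E \<le> pre_bottleneck D' E'"
    if "(D, D') \<in> Dgm_rel" "(E, E') \<in> Dgm_rel" for D D' E E'
    using pre_bottleneck_triangle[of D E D'] pre_bottleneck_triangle[of D' E E'] that
    by (auto simp: Dgm_rel_def pre_bottleneck_commute[of E' E])
  have "sym Dgm_rel" using equiv_Dgm_rel by (simp add: equiv_def)
  with assms le show ?thesis by (meson antisym symD)
qed

lemma bottleneck_class:
  assumes "X \<in> Dgm" "Y \<in> Dgm" "D \<in> X" "E \<in> Y"
  shows "bottleneck X Y = enn2real (pre_bottleneck D E)"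
proof -
  have "(SOME D. D \<in> X) \<in> X" "(SOME E. E \<in> Y) \<in> Y"
    using assms by (auto intro: someI)
  with assms have "((SOME D. D \<in> X), D) \<in> Dgm_rel" "((SOME E. E \<in> Y), E) \<in> Dgm_rel"
    unfolding Dgm_def by (meson equiv_Dgm_rel quotient_eq_iff)+
  then show ?thesis
    unfolding bottleneck_def by (simp add: pre_bottleneck_cong)
qed

lemma Dgm_representative:
  assumes "X \<in> Dgm"
  obtains D where "D \<in> X" "D \<in> Dgm_carrier"
  using assms equiv_Dgm_rel unfolding Dgm_def
  by (metis equiv_class_self quotientE)

lemma Metric_space_Dgm: "Metric_space Dgm bottleneck"
proof
  fix X Y
  show "0 \<le> bottleneck X Y" by (simp add: bottleneck_def)
  show "bottleneck X Y = bottleneck Y X"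
    unfolding bottleneck_def by (subst pre_bottleneck_commute) (rule refl)
next
  fix X Y assume X: "X \<in> Dgm" and Y: "Y \<in> Dgm"
  obtain D where D: "D \<in> X" "D \<in> Dgm_carrier" using X by (rule Dgm_representative)
  obtain E where E: "E \<in> Y" "E \<in> Dgm_carrier" using Y by (rule Dgm_representative)
  have "bottleneck X Y = 0 \<longleftrightarrow> pre_bottleneck D E = 0"
    using pre_bottleneck_finite[OF D(2) E(2)]
    by (auto simp: bottleneck_class[OF X Y D(1) E(1)] enn2real_eq_0_iff)
  also have "\<dots> \<longleftrightarrow> (D, E) \<in> Dgm_rel" using D E by (simp add: Dgm_rel_def)
  also have "\<dots> \<longleftrightarrow> X = Y"
    using quotient_eq_iff[OF equiv_Dgm_rel] X Y D(1) E(1) by (simp add: Dgm_def)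
  finally show "bottleneck X Y = 0 \<longleftrightarrow> X = Y" .
next
  fix X Y Z assume X: "X \<in> Dgm" and Y: "Y \<in> Dgm" and Z: "Z \<in> Dgm"
  obtain D where D: "D \<in> X" "D \<in> Dgm_carrier" using X by (rule Dgm_representative)
  obtain E where E: "E \<in> Y" "E \<in> Dgm_carrier" using Y by (rule Dgm_representative)
  obtain F where F: "F \<in> Z" "F \<in> Dgm_carrier" using Z by (rule Dgm_representative)
  note fin = pre_bottleneck_finite[OF D(2) E(2)] pre_bottleneck_finite[OF E(2) F(2)]
  have "enn2real (pre_bottleneck D F) \<le> enn2real (pre_bottleneck D E + pre_bottleneck E F)"
    using fin by (intro enn2real_mono pre_bottleneck_triangle) (simp add: ennreal_add_less_top)
  also have "\<dots> = enn2real (pre_bottleneck D E) + enn2real (pre_bottleneck E F)"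
    using fin by (intro enn2real_plus) simp_all
  finally show "bottleneck X Z \<le> bottleneck X Y + bottleneck Y Z"
    using X Y Z D(1) E(1) F(1) by (simp add: bottleneck_class)
qed

lemma finite_Dgm_eq:
  "finite_Dgm = (\<lambda>D. Dgm_rel `` {D}) ` {D. persistence_diagram D \<and> finite (fst D)}"
proof (intro equalityI subsetI)
  fix X assume "X \<in> finite_Dgm"
  then obtain D where D: "X \<in> Dgm" "D \<in> X" "finite (fst D)" by (auto simp: finite_Dgm_def)
  then have "X = Dgm_rel `` {D}"
    unfolding Dgm_def by (metis equiv_Dgm_rel Image_singleton_iff equiv_class_eq quotientE)
  moreover have "persistence_diagram D"
    using D(1,2) unfolding Dgm_def by (auto simp: Dgm_rel_def Dgm_carrier_def elim!: quotientE)
  ultimately show "X \<in> (\<lambda>D. Dgm_rel `` {D}) ` {D. persistence_diagram D \<and> finite (fst D)}"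
    using D(3) by blast
next
  fix X assume "X \<in> (\<lambda>D. Dgm_rel `` {D}) ` {D. persistence_diagram D \<and> finite (fst D)}"
  then obtain D where D: "X = Dgm_rel `` {D}" "persistence_diagram D" "finite (fst D)" by blast
  then have "D \<in> Dgm_carrier" by (simp add: finite_diagram_in_Dgm_carrier)
  then have "X \<in> Dgm" "D \<in> X"
    using D(1) equiv_class_self[OF equiv_Dgm_rel] by (auto simp: Dgm_def quotientI)
  with D(3) show "X \<in> finite_Dgm" by (auto simp: finite_Dgm_def)
qed

lemma Metric_space_finite_Dgm: "Metric_space finite_Dgm bottleneck"
  by (rule Metric_space.subspace[OF Metric_space_Dgm]) (auto simp: finite_Dgm_def)

end

(*
  Let n = 2^k and M = 2 n^2, and let G be the group of subsets of {..<M} x {..<n} under symmetric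
  difference, with the metric d(x, y) = the maximum over the n columns of the Hamming distance in
  the column. As G is finite, it embeds isometrically into the maximum norm, hence into the finite
  persistence diagrams: the coordinates become perturbations of points that lie far apart from
  each other and from the diagonal.

  Let B_j be the operator on Hilbert-valued functions on G that averages over the M toggles of one
  element of column j. These operators are self-adjoint and commute, so repeated use of
  2 <Uf, Vf> <= <Uf, Uf> + <Vf, Vf> gives
    <B_0 ... B_(n-1) f, f>  <=  (1/n) * sum_j <B_j^n f, f>.
  On the left f is compared with its translates by elements of norm 1, on the right with
  translates of which at least half have norm n, since n random letters from M are mostly
  distinct. Hence a map f that does not stretch distance 1 beyond C must contract some pair at
  distance n to distance at most sqrt 2 * C, for every n: this is Enflo's doubling argument.
*)
theory Submission
  imports Defs
begin

section \<open>Products of commuting self-adjoint operators\<close>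

text \<open>The composition of \<open>B 0\<close>, ..., \<open>B (2 ^ k - 1)\<close>, bracketed by
  halves so that an induction on \<open>k\<close> can double the number of factors, as in Cauchy's
  proof of the inequality of arithmetic and geometric means.\<close>

primrec dyadic_comp :: "(nat \<Rightarrow> 'v \<Rightarrow> 'v) \<Rightarrow> nat \<Rightarrow> 'v \<Rightarrow> 'v" where
  "dyadic_comp B 0 = B 0"
| "dyadic_comp B (Suc k) = dyadic_comp B k \<circ> dyadic_comp (\<lambda>j. B (j + 2 ^ k)) k"

lemma dyadic_comp_commute:
  assumes "\<And>j. j < 2 ^ k \<Longrightarrow> A \<circ> B j = B j \<circ> A"
  shows "A \<circ> dyadic_comp B k = dyadic_comp B k \<circ> A"
  using assms
proof (induction k arbitrary: B)
  case (Suc k)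
  have 1: "A \<circ> dyadic_comp B k = dyadic_comp B k \<circ> A"
    by (rule Suc.IH) (simp add: Suc.prems)
  have 2: "A \<circ> dyadic_comp (\<lambda>j. B (j + 2 ^ k)) k = dyadic_comp (\<lambda>j. B (j + 2 ^ k)) k \<circ> A"
    by (rule Suc.IH) (simp add: Suc.prems)
  show ?case using 1 2 by (simp add: fun_eq_iff)
qed simp

lemma dyadic_comp_halves_commute:
  assumes "\<And>i j. i < 2 ^ Suc k \<Longrightarrow> j < 2 ^ Suc k \<Longrightarrow> B i \<circ> B j = B j \<circ> B i"
  shows "dyadic_comp B k \<circ> dyadic_comp (\<lambda>j. B (j + 2 ^ k)) k
       = dyadic_comp (\<lambda>j. B (j + 2 ^ k)) k \<circ> dyadic_comp B k"
  by (intro dyadic_comp_commute sym[OF dyadic_comp_commute] assms) simp_all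

text \<open>As the two halves \<open>P\<close> and \<open>Q\<close> commute,
  \<open>P Q P Q = P P Q Q\<close>. This serves to rewrite the squared norm of \<open>P f\<close>
  through the operators \<open>B j \<circ> B j\<close>.\<close>

lemma dyadic_comp_square:
  assumes "\<And>i j. i < 2 ^ k \<Longrightarrow> j < 2 ^ k \<Longrightarrow> B i \<circ> B j = B j \<circ> B i"
  shows "dyadic_comp B k \<circ> dyadic_comp B k = dyadic_comp (\<lambda>j. B j \<circ> B j) k"
  using assms
proof (induction k arbitrary: B)
  case (Suc k)
  let ?C = "\<lambda>j. B (j + 2 ^ k)"
  have 1: "dyadic_comp B k \<circ> dyadic_comp B k = dyadic_comp (\<lambda>j. B j \<circ> B j) k"
    by (rule Suc.IH) (simp add: Suc.prems)
  have 2: "dyadic_comp ?C k \<circ> dyadic_comp ?C k = dyadic_comp (\<lambda>j. ?C j \<circ> ?C j) k"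
    by (rule Suc.IH) (simp add: Suc.prems)
  have 3: "dyadic_comp B k \<circ> dyadic_comp ?C k = dyadic_comp ?C k \<circ> dyadic_comp B k"
    by (rule dyadic_comp_halves_commute) (rule Suc.prems)
  show ?case unfolding dyadic_comp.simps 1[symmetric] 2[symmetric]
    using 3 by (simp add: fun_eq_iff)
qed (simp add: fun_eq_iff)

text \<open>Moving the two halves across \<open>ip\<close> one after the other reverses their order;
  commutativity restores it.\<close>

lemma dyadic_comp_self_adjoint:
  assumes "\<And>i j. i < 2 ^ k \<Longrightarrow> j < 2 ^ k \<Longrightarrow> B i \<circ> B j = B j \<circ> B i"
    and "\<And>j f g. j < 2 ^ k \<Longrightarrow> ip (B j f) g = ip f (B j g)"
  shows "ip (dyadic_comp B k f) g = ip f (dyadic_comp B k g)"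
  using assms
proof (induction k arbitrary: B f g)
  case (Suc k)
  let ?C = "\<lambda>j. B (j + 2 ^ k)"
  have 1: "ip (dyadic_comp B k f) g = ip f (dyadic_comp B k g)" for f g
    by (rule Suc.IH) (simp_all add: Suc.prems)
  have 2: "ip (dyadic_comp ?C k f) g = ip f (dyadic_comp ?C k g)" for f g
    by (rule Suc.IH) (simp_all add: Suc.prems)
  have 3: "dyadic_comp B k \<circ> dyadic_comp ?C k = dyadic_comp ?C k \<circ> dyadic_comp B k"
    by (rule dyadic_comp_halves_commute) (rule Suc.prems)
  show ?case using 1 2 3 by (simp add: fun_eq_iff)
qed simp

text \<open>For positive scalars \<open>B j\<close> this is the inequality of arithmetic and geometric means.\<close>

lemma dyadic_comp_am_gm:
  fixes ip :: "'v \<Rightarrow> 'v \<Rightarrow> real"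
  assumes "\<And>i j. i < 2 ^ k \<Longrightarrow> j < 2 ^ k \<Longrightarrow> B i \<circ> B j = B j \<circ> B i"
    and "\<And>j f g. j < 2 ^ k \<Longrightarrow> ip (B j f) g = ip f (B j g)"
    and ip: "\<And>f g. 2 * ip f g \<le> ip f f + ip g g"
  shows "2 ^ k * ip (dyadic_comp B k f) f \<le> (\<Sum>j<2 ^ k. ip ((B j ^^ 2 ^ k) f) f)"
  using assms(1,2)
proof (induction k arbitrary: B)
  case (Suc k)
  note comm = Suc.prems(1) and adj = Suc.prems(2)
  let ?C = "\<lambda>j. B (j + 2 ^ k)"
  let ?P = "dyadic_comp B k" and ?Q = "dyadic_comp ?C k"
  \<comment> \<open>The squared norm of \<open>P f\<close> is the inner product of
    \<open>P (P f)\<close> with \<open>f\<close>, so the induction hypothesis can be used for the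
    squares \<open>D j \<circ> D j\<close>; this is what doubles the exponent.\<close>
  have half: "2 ^ k * ip (dyadic_comp D k f) (dyadic_comp D k f)
      \<le> (\<Sum>j<2 ^ k. ip ((D j ^^ 2 ^ Suc k) f) f)"
    if c: "\<And>i j. i < 2 ^ k \<Longrightarrow> j < 2 ^ k \<Longrightarrow> D i \<circ> D j = D j \<circ> D i"
      and a: "\<And>j f g. j < 2 ^ k \<Longrightarrow> ip (D j f) g = ip f (D j g)" for D
  proof -
    have "ip (dyadic_comp D k f) (dyadic_comp D k f)
        = ip f ((dyadic_comp D k \<circ> dyadic_comp D k) f)"
      by (simp add: dyadic_comp_self_adjoint[where ip = ip, OF c a])
    also have "\<dots> = ip f (dyadic_comp (\<lambda>j. D j \<circ> D j) k f)"
      by (simp only: dyadic_comp_square[OF c])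
    also have "\<dots> = ip (dyadic_comp (\<lambda>j. D j \<circ> D j) k f) f"
    proof (rule dyadic_comp_self_adjoint[where ip = ip, symmetric])
      fix i j :: nat assume "i < 2 ^ k" "j < 2 ^ k"
      then show "(D i \<circ> D i) \<circ> (D j \<circ> D j) = (D j \<circ> D j) \<circ> (D i \<circ> D i)"
        using c[of i j] by (simp add: fun_eq_iff)
    qed (simp add: a)
    finally have eq: "ip (dyadic_comp D k f) (dyadic_comp D k f)
        = ip (dyadic_comp (\<lambda>j. D j \<circ> D j) k f) f" .
    have "2 ^ k * ip (dyadic_comp (\<lambda>j. D j \<circ> D j) k f) f
        \<le> (\<Sum>j<2 ^ k. ip (((D j \<circ> D j) ^^ 2 ^ k) f) f)"
    proof (rule Suc.IH)
      fix i j :: nat assume "i < 2 ^ k" "j < 2 ^ k"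
      then show "(D i \<circ> D i) \<circ> (D j \<circ> D j) = (D j \<circ> D j) \<circ> (D i \<circ> D i)"
        using c[of i j] by (simp add: fun_eq_iff)
    qed (simp add: a)
    moreover have "(D j \<circ> D j) ^^ 2 ^ k = D j ^^ 2 ^ Suc k" for j
      using funpow_mult[where m = 2 and f = "D j" and n = "2 ^ k"] by (simp add: numeral_2_eq_2)
    ultimately show ?thesis unfolding eq by simp
  qed
  \<comment> \<open>Moving the half \<open>?P\<close> to the other side leaves an inner product of
    two vectors; \<open>ip\<close> splits it into two squared norms, and \<open>half\<close> bounds
    each.\<close>
  have "ip (dyadic_comp B (Suc k) f) f = ip (?Q f) (?P f)"
  proof -
    have "ip (?P g) h = ip g (?P h)" for g h
      by (rule dyadic_comp_self_adjoint[where ip = ip]; intro comm adj; simp)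
    then show ?thesis by simp
  qed
  then have "2 ^ Suc k * ip (dyadic_comp B (Suc k) f) f
      \<le> 2 ^ k * ip (?Q f) (?Q f) + 2 ^ k * ip (?P f) (?P f)"
    using mult_left_mono[OF ip[of "?Q f" "?P f"], of "2 ^ k"] by (simp add: algebra_simps)
  also have "\<dots> \<le> (\<Sum>j<2 ^ k. ip ((?C j ^^ 2 ^ Suc k) f) f)
      + (\<Sum>j<2 ^ k. ip ((B j ^^ 2 ^ Suc k) f) f)"
    by (intro add_mono half; intro comm adj; simp)
  also have "\<dots> = (\<Sum>j<2 ^ Suc k. ip ((B j ^^ 2 ^ Suc k) f) f)"
  proof -
    let ?g = "\<lambda>j. ip ((B j ^^ 2 ^ Suc k) f) f"
    have "(\<Sum>j<2 ^ k. ?g (j + 2 ^ k)) = (\<Sum>j = 2 ^ k..<2 ^ k + 2 ^ k. ?g j)"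
      using sum.shift_bounds_nat_ivl[of ?g 0 "2 ^ k" "2 ^ k"] by (simp only: lessThan_atLeast0 add_0)
    moreover have "(\<Sum>j<2 ^ k. ?g j) + (\<Sum>j = 2 ^ k..<2 ^ k + 2 ^ k. ?g j)
        = (\<Sum>j<2 ^ k + 2 ^ k. ?g j)"
      using sum.atLeastLessThan_concat[of 0 "2 ^ k" "2 ^ k + 2 ^ k" ?g]
      by (simp only: lessThan_atLeast0 le_add1 zero_le)
    moreover have "(2::nat) ^ Suc k = 2 ^ k + 2 ^ k" by simp
    ultimately show ?thesis by (simp only: add.commute)
  qed
  finally show ?case .
qed simp

section \<open>Averages of translations of the cube\<close>

text \<open>A list stands for the uniform law on its entries in the group of sets under symmetric
  difference, and the operator averages over a random translation with that law. Lists replace sets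
  because repeated entries must keep their weight.\<close>

definition shift_mean :: "'a set list \<Rightarrow> ('a set \<Rightarrow> 'h :: real_vector) \<Rightarrow> 'a set \<Rightarrow> 'h" where
  "shift_mean zs f x = (\<Sum>z\<leftarrow>zs. f (sym_diff x z)) /\<^sub>R real (length zs)"

text \<open>The law of the product of two independent random elements. Hence
  \<open>conv_power\<close> describes a walk of \<open>n\<close> steps from the identity
  \<open>{}\<close>, and \<open>dyadic_conv\<close> the product of one independent element from each
  \<open>Z j\<close> with \<open>j < 2 ^ k\<close>.\<close>

definition conv :: "'a set list \<Rightarrow> 'a set list \<Rightarrow> 'a set list" where
  "conv zs ws = concat (map (\<lambda>z. map (sym_diff z) ws) zs)"

primrec conv_power :: "'a set list \<Rightarrow> nat \<Rightarrow> 'a set list" where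
  "conv_power zs 0 = [{}]"
| "conv_power zs (Suc n) = conv zs (conv_power zs n)"

primrec dyadic_conv :: "(nat \<Rightarrow> 'a set list) \<Rightarrow> nat \<Rightarrow> 'a set list" where
  "dyadic_conv Z 0 = Z 0"
| "dyadic_conv Z (Suc k) = conv (dyadic_conv Z k) (dyadic_conv (\<lambda>j. Z (j + 2 ^ k)) k)"

definition l2_inner :: "'a set \<Rightarrow> ('a set \<Rightarrow> 'h :: real_inner) \<Rightarrow> ('a set \<Rightarrow> 'h) \<Rightarrow> real" where
  "l2_inner \<Omega> f g = (\<Sum>x\<in>Pow \<Omega>. f x \<bullet> g x)"

lemma sym_diff_commute: "sym_diff x y = sym_diff y x"
  by auto

lemma sym_diff_assoc: "sym_diff (sym_diff x y) z = sym_diff x (sym_diff y z)"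
  by auto

lemma length_conv [simp]: "length (conv zs ws) = length zs * length ws"
  by (induction zs) (simp_all add: conv_def)

lemma sum_list_conv:
  "(\<Sum>z\<leftarrow>conv zs ws. g z) = (\<Sum>z\<leftarrow>zs. \<Sum>w\<leftarrow>ws. g (sym_diff z w))"
  by (induction zs) (simp_all add: conv_def o_def)

lemma set_conv: "set (conv zs ws) = {sym_diff z w | z w. z \<in> set zs \<and> w \<in> set ws}"
  by (auto simp: conv_def)

lemma length_conv_power [simp]: "length (conv_power zs n) = length zs ^ n"
  by (induction n) simp_all

lemma shift_mean_conv:
  fixes f :: "'a set \<Rightarrow> 'h :: real_vector"
  shows "shift_mean (conv zs ws) f = shift_mean zs (shift_mean ws f)"
proof -
  have "(\<Sum>z\<leftarrow>zs. a *\<^sub>R g z) = a *\<^sub>R (\<Sum>z\<leftarrow>zs. g z)" for a and g :: "'a set \<Rightarrow> 'h"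
    by (induction zs) (simp_all add: scaleR_add_right)
  then show ?thesis
    by (simp add: fun_eq_iff shift_mean_def sum_list_conv sym_diff_assoc)
qed

lemma shift_mean_commute:
  fixes f :: "'a set \<Rightarrow> 'h :: real_vector"
  shows "shift_mean zs (shift_mean ws f) = shift_mean ws (shift_mean zs f)"
proof -
  have "(\<Sum>z\<leftarrow>zs. \<Sum>w\<leftarrow>ws. g z w) = (\<Sum>w\<leftarrow>ws. \<Sum>z\<leftarrow>zs. g z w)"
    for g :: "'a set \<Rightarrow> 'a set \<Rightarrow> 'h"
    by (induction zs) (simp_all add: sum_list_addf)
  then show ?thesis
    unfolding shift_mean_conv[symmetric]
    by (simp add: fun_eq_iff shift_mean_def sum_list_conv mult.commute)
       (simp add: sym_diff_commute)
qed

lemma shift_mean_conv_power: "shift_mean (conv_power zs n) f = (shift_mean zs ^^ n) f"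
  by (induction n) (simp_all add: shift_mean_conv, simp add: shift_mean_def)

text \<open>Thus the product of the averaging operators is again an average over translations, and
  its inner products can be expressed by distances.\<close>

lemma shift_mean_dyadic_conv:
  "shift_mean (dyadic_conv Z k) = dyadic_comp (\<lambda>j. shift_mean (Z j)) k"
proof (induction k arbitrary: Z)
  case (Suc k)
  show ?case by (simp add: shift_mean_conv[abs_def] Suc.IH[symmetric] o_def)
qed simp

lemma dyadic_conv_nonempty:
  assumes "\<And>j. j < 2 ^ k \<Longrightarrow> Z j \<noteq> []"
  shows "dyadic_conv Z k \<noteq> []"
  using assms
proof (induction k arbitrary: Z)
  case (Suc k)
  have "dyadic_conv Z k \<noteq> []" "dyadic_conv (\<lambda>j. Z (j + 2 ^ k)) k \<noteq> []"
    by (intro Suc; simp add: Suc.prems)+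
  then show ?case by (simp flip: length_greater_0_conv)
qed simp

section \<open>Inner products of functions on the finite cube\<close>

lemma sum_Pow_sym_diff:
  assumes "z \<subseteq> \<Omega>"
  shows "(\<Sum>x\<in>Pow \<Omega>. g (sym_diff x z)) = (\<Sum>x\<in>Pow \<Omega>. g x)"
  by (rule sum.reindex_bij_witness[where i = "\<lambda>x. sym_diff x z" and j = "\<lambda>x. sym_diff x z"])
     (use assms in \<open>auto intro: arg_cong[where f = g]\<close>)

lemma l2_inner_shift_mean:
  "l2_inner \<Omega> (shift_mean zs f) g
     = (\<Sum>z\<leftarrow>zs. \<Sum>x\<in>Pow \<Omega>. f (sym_diff x z) \<bullet> g x) / real (length zs)"
proof -
  have "(\<Sum>x\<in>Pow \<Omega>. (\<Sum>z\<leftarrow>zs. f (sym_diff x z)) \<bullet> g x)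
      = (\<Sum>z\<leftarrow>zs. \<Sum>x\<in>Pow \<Omega>. f (sym_diff x z) \<bullet> g x)"
    by (induction zs) (simp_all add: inner_add_left sum.distrib)
  then show ?thesis
    by (simp add: l2_inner_def shift_mean_def sum_divide_distrib divide_inverse mult.commute
        flip: sum_distrib_left)
qed

lemma l2_inner_commute: "l2_inner \<Omega> f g = l2_inner \<Omega> g f"
  by (simp add: l2_inner_def inner_commute)

text \<open>Every element of the group is its own inverse, so each single translation is
  self-adjoint, and so is an average of translations.\<close>

lemma l2_inner_shift_mean_self_adjoint:
  assumes "set zs \<subseteq> Pow \<Omega>"
  shows "l2_inner \<Omega> (shift_mean zs f) g = l2_inner \<Omega> f (shift_mean zs g)"
proof -
  have "(\<Sum>x\<in>Pow \<Omega>. f (sym_diff x z) \<bullet> g x) = (\<Sum>x\<in>Pow \<Omega>. g (sym_diff x z) \<bullet> f x)"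
    if "z \<subseteq> \<Omega>" for z
  proof -
    have "sym_diff (sym_diff x z) z = x" for x by auto
    then show ?thesis
      using sum_Pow_sym_diff[OF that, of "\<lambda>x. f (sym_diff x z) \<bullet> g x"]
      by (simp add: inner_commute)
  qed
  then have "(\<Sum>z\<leftarrow>zs. \<Sum>x\<in>Pow \<Omega>. f (sym_diff x z) \<bullet> g x)
      = (\<Sum>z\<leftarrow>zs. \<Sum>x\<in>Pow \<Omega>. g (sym_diff x z) \<bullet> f x)"
    using assms by (intro arg_cong[where f = sum_list] map_cong) auto
  then show ?thesis
    by (simp add: l2_inner_shift_mean l2_inner_commute[of \<Omega> f])
qed

lemma l2_inner_le: "2 * l2_inner \<Omega> f g \<le> l2_inner \<Omega> f f + l2_inner \<Omega> g g"
proof -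
  have "2 * (f x \<bullet> g x) \<le> f x \<bullet> f x + g x \<bullet> g x" for x
    using inner_ge_zero[of "f x - g x"] by (simp add: inner_diff inner_commute)
  then show ?thesis
    unfolding l2_inner_def sum_distrib_left sum.distrib[symmetric] by (intro sum_mono) auto
qed

text \<open>Expand the squared distance; the two square terms have the same sum by translation
  invariance. This identity translates between operators and distances.\<close>

lemma l2_inner_shift_mean_dist:
  assumes "set zs \<subseteq> Pow \<Omega>" "zs \<noteq> []"
  shows "2 * (l2_inner \<Omega> f f - l2_inner \<Omega> (shift_mean zs f) f) * real (length zs)
     = (\<Sum>z\<leftarrow>zs. \<Sum>x\<in>Pow \<Omega>. (dist (f x) (f (sym_diff x z)))\<^sup>2)"
proof -
  have "(\<Sum>x\<in>Pow \<Omega>. (dist (f x) (f (sym_diff x z)))\<^sup>2)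
      = 2 * l2_inner \<Omega> f f - 2 * (\<Sum>x\<in>Pow \<Omega>. f (sym_diff x z) \<bullet> f x)" if "z \<subseteq> \<Omega>" for z
  proof -
    have "(dist (f x) (f (sym_diff x z)))\<^sup>2 = f x \<bullet> f x
        + f (sym_diff x z) \<bullet> f (sym_diff x z) - 2 * (f (sym_diff x z) \<bullet> f x)" for x
      by (simp add: dist_norm power2_norm_eq_inner inner_diff inner_commute)
    then show ?thesis
      using sum_Pow_sym_diff[OF that, of "\<lambda>x. f x \<bullet> f x"]
      by (simp add: l2_inner_def sum.distrib sum_subtractf flip: sum_distrib_left)
  qed
  then have "(\<Sum>z\<leftarrow>zs. \<Sum>x\<in>Pow \<Omega>. (dist (f x) (f (sym_diff x z)))\<^sup>2)
      = (\<Sum>z\<leftarrow>zs. 2 * l2_inner \<Omega> f f - 2 * (\<Sum>x\<in>Pow \<Omega>. f (sym_diff x z) \<bullet> f x))"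
    using assms(1) by (intro arg_cong[where f = sum_list] map_cong) auto
  also have "\<dots> = 2 * l2_inner \<Omega> f f * real (length zs)
      - 2 * (\<Sum>z\<leftarrow>zs. \<Sum>x\<in>Pow \<Omega>. f (sym_diff x z) \<bullet> f x)"
    by (induction zs) (simp_all add: algebra_simps)
  finally show ?thesis
    using assms(2) by (simp add: l2_inner_shift_mean algebra_simps)
qed

section \<open>Cardinalities and columns of the translating sets\<close>

lemma sum_list_bool: "(\<Sum>z\<leftarrow>zs. if P z then 1 else 0) = real (length (filter P zs))"
  by (induction zs) simp_all

text \<open>A word of \<open>n\<close> letters from an alphabet of size \<open>M\<close> has a repetition with probability at
  most \<open>n\<^sup>2 / M\<close>.\<close>

lemma conv_power_singletons_repetitions:
  fixes j :: 'b and M n :: nat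
  defines "zs \<equiv> map (\<lambda>i. {(i, j)}) [0..<M]"
  shows "real M * real (length (filter (\<lambda>z. card z \<noteq> n) (conv_power zs n)))
     \<le> real (n ^ 2 * M ^ n)"
proof (induction n)
  case 0
  show ?case by simp
next
  case (Suc n)
  let ?bad = "\<lambda>n z. if card z \<noteq> n then 1 else 0 :: real"
  let ?W = "conv_power zs n"
  have fin: "finite z" if "z \<in> set (conv_power zs m)" for z m
    using that by (induction m arbitrary: z) (auto simp: set_conv zs_def)
  have sub: "z \<subseteq> UNIV \<times> {j}" if "z \<in> set (conv_power zs m)" for z m
    using that by (induction m arbitrary: z) (fastforce simp: set_conv zs_def)+
  have "real (length (filter (\<lambda>z. card z \<noteq> Suc n) (conv_power zs (Suc n))))
      = (\<Sum>i\<leftarrow>[0..<M]. \<Sum>z\<leftarrow>?W. ?bad (Suc n) (sym_diff {(i, j)} z))"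
    unfolding sum_list_bool[symmetric] by (simp add: sum_list_conv) (simp add: zs_def o_def)
  also have "\<dots> = (\<Sum>z\<leftarrow>?W. \<Sum>i<M. ?bad (Suc n) (sym_diff {(i, j)} z))"
  proof -
    have "(\<Sum>i<M. \<Sum>z\<leftarrow>ws. g i z) = (\<Sum>z\<leftarrow>ws. \<Sum>i<M. g i z)"
      for ws and g :: "nat \<Rightarrow> (nat \<times> 'b) set \<Rightarrow> real"
      by (induction ws) (simp_all add: sum.distrib)
    then show ?thesis by (simp add: interv_sum_list_conv_sum_set_nat atLeast0LessThan)
  qed
  \<comment> \<open>A word that is already bad is charged for all \<open>M\<close> choices of the
    new letter, a good one only for the at most \<open>n\<close> letters that it contains.\<close>
  also have "\<dots> \<le> (\<Sum>z\<leftarrow>?W. real M * ?bad n z + real n)"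
  proof (rule sum_list_mono)
    fix z assume z: "z \<in> set ?W"
    show "(\<Sum>i<M. ?bad (Suc n) (sym_diff {(i, j)} z)) \<le> real M * ?bad n z + real n"
    proof (cases "card z = n")
      case True
      \<comment> \<open>A letter outside \<open>z\<close> raises the cardinality from
        \<open>n\<close> to \<open>Suc n\<close>, so only a letter of \<open>z\<close> can make the
        new word bad.\<close>
      have "?bad (Suc n) (sym_diff {(i, j)} z) \<le> (if (i, j) \<in> z then 1 else 0)" for i
        using True fin[OF z] by (auto simp: insert_Diff_if)
      then have "(\<Sum>i<M. ?bad (Suc n) (sym_diff {(i, j)} z)) \<le> (\<Sum>i<M. if (i, j) \<in> z then 1 else 0)"
        by (intro sum_mono)
      also have "\<dots> = real (card {i\<in>{..<M}. (i, j) \<in> z})"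
        by (simp add: sum.If_cases Int_def)
      also have "card {i\<in>{..<M}. (i, j) \<in> z} \<le> card z"
        by (rule card_inj_on_le[where f = "\<lambda>i. (i, j)"]) (auto simp: inj_on_def fin[OF z])
      finally show ?thesis using True by simp
    next
      case False
      have "(\<Sum>i<M. ?bad (Suc n) (sym_diff {(i, j)} z)) \<le> (\<Sum>i<M. 1)"
        by (intro sum_mono) simp
      then show ?thesis using False by simp
    qed
  qed
  also have "\<dots> = real M * real (length (filter (\<lambda>z. card z \<noteq> n) ?W)) + real n * real (length ?W)"
    unfolding sum_list_bool[symmetric]
    by (simp only: sum_list_addf sum_list_const_mult sum_list_triv) simp
  also have "\<dots> \<le> real (n ^ 2 * M ^ n) + real n * real M ^ n"
    using Suc.IH by (simp add: zs_def)
  finally have "real (length (filter (\<lambda>z. card z \<noteq> Suc n) (conv_power zs (Suc n))))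
      \<le> real (n ^ 2 * M ^ n) + real n * real M ^ n" .
  then have "real M * real (length (filter (\<lambda>z. card z \<noteq> Suc n) (conv_power zs (Suc n))))
      \<le> real M * (real (n ^ 2 * M ^ n) + real n * real M ^ n)"
    by (rule mult_left_mono) simp
  also have "\<dots> = real (n\<^sup>2 + n) * real (M ^ Suc n)" by (simp add: algebra_simps)
  also have "\<dots> \<le> real ((Suc n)\<^sup>2) * real (M ^ Suc n)"
    by (intro mult_right_mono) (simp_all add: power2_eq_square algebra_simps)
  finally show ?case by simp
qed

lemma conv_power_subset:
  assumes "\<And>z. z \<in> set zs \<Longrightarrow> z \<subseteq> S" "z \<in> set (conv_power zs n)"
  shows "z \<subseteq> S"
  using assms(2)
proof (induction n arbitrary: z)
  case (Suc n)
  then obtain a b where "z = sym_diff a b" "a \<in> set zs" "b \<in> set (conv_power zs n)"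
    by (auto simp: set_conv)
  with Suc.IH assms(1) show ?case by blast
qed simp

lemma dyadic_conv_subset:
  assumes "\<And>j z. j < 2 ^ k \<Longrightarrow> z \<in> set (Z j) \<Longrightarrow> z \<subseteq> S" "z \<in> set (dyadic_conv Z k)"
  shows "z \<subseteq> S"
  using assms
proof (induction k arbitrary: z Z)
  case (Suc k)
  let ?Z = "\<lambda>j. Z (j + 2 ^ k)"
  obtain a b where ab: "z = sym_diff a b" "a \<in> set (dyadic_conv Z k)" "b \<in> set (dyadic_conv ?Z k)"
    using Suc.prems(2) by (auto simp: set_conv)
  have "a \<subseteq> S" by (rule Suc.IH[OF _ ab(2)], rule Suc.prems(1)) simp_all
  moreover have "b \<subseteq> S" by (rule Suc.IH[OF _ ab(3)], rule Suc.prems(1)) simp_all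
  ultimately show ?case using ab(1) by auto
qed simp

text \<open>The factors with index below and above \<open>2 ^ k\<close> live in disjoint columns.\<close>

lemma dyadic_conv_columns:
  assumes "z \<in> set (dyadic_conv (\<lambda>j. map (\<lambda>i. {(i, j + a)}) [0..<M]) k)"
  shows "card {i. (i, j) \<in> z} \<le> 1"
proof -
  \<comment> \<open>The offset \<open>a\<close> is general because the second half starts at column
    \<open>a + 2 ^ k\<close>. Injectivity of \<open>snd\<close> means that no column is met
    twice.\<close>
  have *: "snd ` z \<subseteq> {a..<a + 2 ^ k} \<and> inj_on snd z \<and> finite z"
    using assms
  proof (induction k arbitrary: z a)
    case 0
    then show ?case by auto
  next
    case (Suc k)
    obtain u w where uw: "z = sym_diff u w"
      "u \<in> set (dyadic_conv (\<lambda>j. map (\<lambda>i. {(i, j + a)}) [0..<M]) k)"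
      "w \<in> set (dyadic_conv (\<lambda>j. map (\<lambda>i. {(i, j + (a + 2 ^ k))}) [0..<M]) k)"
      using Suc.prems by (auto simp: set_conv ac_simps)
    note u = Suc.IH[OF uw(2)] and w = Suc.IH[OF uw(3)]
    have disj: "snd ` u \<inter> snd ` w = {}" using u w by fastforce
    then have "z = u \<union> w" using uw(1) by blast
    moreover have "inj_on snd (u \<union> w)"
      using u w disj by (intro inj_on_Un[THEN iffD2]) blast
    moreover have "snd ` (u \<union> w) \<subseteq> {a..<a + 2 ^ Suc k}"
    proof -
      have "{a..<a + 2 ^ k} \<union> {a + 2 ^ k..<a + 2 ^ k + 2 ^ k} \<subseteq> {a..<a + 2 ^ Suc k}" by auto
      then show ?thesis using u w by (fastforce simp: image_Un)
    qed
    ultimately show ?case using u w by simp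
  qed
  have "card {i. (i, j) \<in> z} \<le> card {j}"
  proof (cases "{i. (i, j) \<in> z} = {}")
    case False
    then obtain i where i: "(i, j) \<in> z" by auto
    then have "{i. (i, j) \<in> z} = {i}" using * by (auto dest: inj_onD[of snd z "(_, j)" "(i, j)"])
    then show ?thesis by simp
  next
    case True
    then show ?thesis by simp
  qed
  then show ?thesis by simp
qed

section \<open>Embedding the maximum norm into the bottleneck distance\<close>

text \<open>The points are pairwise far apart and far from the diagonal, so that a matching of cost
  below \<open>L\<close> must match each of them to the point with the same index.\<close>

definition spread_diagram :: "real \<Rightarrow> nat set \<Rightarrow> (nat \<Rightarrow> real) \<Rightarrow> nat diagram" where
  "spread_diagram L J v =
     (J, \<lambda>i\<in>J. (4 * (L + 1) * real i, 4 * (L + 1) * real i + 2 * (L + 1) + v i))"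

lemma fst_spread_diagram [simp]: "fst (spread_diagram L J v) = J"
  by (simp add: spread_diagram_def)

lemma persistence_diagram_spread:
  assumes "0 \<le> L" "\<And>i. i \<in> J \<Longrightarrow> 0 \<le> v i"
  shows "persistence_diagram (spread_diagram L J v)"
proof -
  have "2 * (L + 1) + v i > 0" if "i \<in> J" for i
    using assms(1) assms(2)[OF that] by (simp add: algebra_simps)
  then show ?thesis
    by (auto simp: persistence_diagram_def spread_diagram_def half_plane_def add.assoc)
qed

lemma pre_bottleneck_spread_le:
  assumes "\<And>i. i \<in> J \<Longrightarrow> \<bar>v i - w i\<bar> \<le> c"
  shows "pre_bottleneck (spread_diagram L J v) (spread_diagram L J w) \<le> ennreal c"
proof (rule pre_bottleneck_le[of _ _ "(J, J, id)"])
  show "matching_cost (spread_diagram L J v) (spread_diagram L J w) (J, J, id) \<le> ennreal c"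
    unfolding matching_cost_le_iff using assms
    by (auto simp: spread_diagram_def dinf_def intro!: ennreal_leI)
qed (simp add: partial_matching_def spread_diagram_def)

text \<open>A counterexample would be a matching of cost below \<open>L\<close>. But every point is
  at least \<open>L + 1\<close> away from the diagonal, and points with different indices are at
  least \<open>4 * (L + 1)\<close> apart, so \<open>i\<close> must be matched to itself, at cost at
  least \<open>\<bar>v i - w i\<bar>\<close>.\<close>

lemma pre_bottleneck_spread_ge:
  assumes "0 \<le> L" and v: "\<And>i. i \<in> J \<Longrightarrow> 0 \<le> v i \<and> v i \<le> L"
    and w: "\<And>i. i \<in> J \<Longrightarrow> 0 \<le> w i \<and> w i \<le> L" and i: "i \<in> J"
  shows "ennreal \<bar>v i - w i\<bar> \<le> pre_bottleneck (spread_diagram L J v) (spread_diagram L J w)"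
    (is "_ \<le> pre_bottleneck ?D ?E")
proof (rule ccontr)
  assume "\<not> ?thesis"
  then have "pre_bottleneck ?D ?E < ennreal \<bar>v i - w i\<bar>" by simp
  then obtain A B f where m: "A \<subseteq> J" "B \<subseteq> J" "bij_betw f A B"
    "matching_cost ?D ?E (A, B, f) < ennreal \<bar>v i - w i\<bar>"
    by (rule pre_bottleneck_less) (simp add: spread_diagram_def)
  have le_L: "\<bar>v i - w i\<bar> \<le> L" using v[OF i] w[OF i] by linarith
  have snd_D: "snd ?D j = (4 * (L + 1) * real j, 4 * (L + 1) * real j + 2 * (L + 1) + v j)"
    and snd_E: "snd ?E j = (4 * (L + 1) * real j, 4 * (L + 1) * real j + 2 * (L + 1) + w j)"
    if "j \<in> J" for j using that by (simp_all add: spread_diagram_def)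
  have "i \<in> A"
  proof (rule ccontr)
    assume "i \<notin> A"
    with i have "ennreal (dinf_diag (snd ?D i)) \<le> matching_cost ?D ?E (A, B, f)"
      using order_refl[of "matching_cost ?D ?E (A, B, f)"]
      unfolding matching_cost_le_iff by (simp add: spread_diagram_def)
    also note m(4)
    finally have "dinf_diag (snd ?D i) < \<bar>v i - w i\<bar>"
      by (simp add: ennreal_less_iff dinf_diag_nonneg)
    moreover have "dinf_diag (snd ?D i) \<ge> L + 1"
      using v[OF i] \<open>0 \<le> L\<close> by (simp add: dinf_diag_eq snd_D[OF i])
    ultimately show False using le_L by simp
  qed
  then have fJ: "f i \<in> J" using m(2,3) by (auto simp: bij_betw_def)
  have "ennreal (dinf (snd ?D i) (snd ?E (f i))) \<le> matching_cost ?D ?E (A, B, f)"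
    using order_refl[of "matching_cost ?D ?E (A, B, f)"] \<open>i \<in> A\<close>
    unfolding matching_cost_le_iff by blast
  also note m(4)
  finally have lt: "dinf (snd ?D i) (snd ?E (f i)) < \<bar>v i - w i\<bar>"
    by (simp add: ennreal_less_iff dinf_nonneg)
  show False
  proof (cases "f i = i")
    case True
    then show False using lt by (simp add: dinf_def snd_D[OF i] snd_E[OF i])
  next
    case False
    then have "1 \<le> \<bar>real i - real (f i)\<bar>" by linarith
    then have "4 * (L + 1) * 1 \<le> 4 * (L + 1) * \<bar>real i - real (f i)\<bar>"
      using \<open>0 \<le> L\<close> by (intro mult_left_mono) simp_all
    also have "\<dots> = \<bar>fst (snd ?D i) - fst (snd ?E (f i))\<bar>"
      using \<open>0 \<le> L\<close> by (simp add: snd_D[OF i] snd_E[OF fJ] abs_mult flip: right_diff_distrib)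
    also have "\<dots> \<le> dinf (snd ?D i) (snd ?E (f i))" by (simp add: dinf_def)
    finally show False using lt le_L \<open>0 \<le> L\<close> by (simp add: algebra_simps)
  qed
qed

text \<open>Together the two estimates say that \<open>F\<close> carries the maximum norm distance
  of the families \<open>v x\<close> to the bottleneck distance.\<close>

lemma finite_family_in_finite_Dgm:
  fixes v :: "'a \<Rightarrow> 'k \<Rightarrow> real"
  assumes K: "finite K" and v: "\<And>x k. x \<in> X \<Longrightarrow> k \<in> K \<Longrightarrow> 0 \<le> v x k \<and> v x k \<le> L"
  obtains F where "F \<in> X \<rightarrow> finite_Dgm"
    "\<And>x y c. x \<in> X \<Longrightarrow> y \<in> X \<Longrightarrow> 0 \<le> c \<Longrightarrow> (\<And>k. k \<in> K \<Longrightarrow> \<bar>v x k - v y k\<bar> \<le> c) \<Longrightarrow>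
       bottleneck (F x) (F y) \<le> c"
    "\<And>x y k. x \<in> X \<Longrightarrow> y \<in> X \<Longrightarrow> k \<in> K \<Longrightarrow> \<bar>v x k - v y k\<bar> \<le> bottleneck (F x) (F y)"
proof -
  obtain h :: "'k \<Rightarrow> nat" where h: "inj_on h K"
    using finite_imp_inj_to_nat_seg[OF K] by blast
  let ?J = "h ` K"
  \<comment> \<open>If \<open>X\<close> or \<open>K\<close> is empty, \<open>L\<close> may be
    negative, while the spread diagrams ask for a nonnegative bound.\<close>
  define M where "M = max L 0"
  define u where "u x i = v x (the_inv_into K h i)" for x i
  have u_h: "u x (h k) = v x k" if "k \<in> K" for x k
    using that by (simp add: u_def the_inv_into_f_f[OF h])
  have M: "0 \<le> M" by (simp add: M_def)
  have bounds: "0 \<le> u x i \<and> u x i \<le> M" if "x \<in> X" "i \<in> ?J" for x i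
    using that v[of x] by (auto simp: u_h M_def le_max_iff_disj)
  define D where "D x = spread_diagram M ?J (u x)" for x
  define F where "F x = Dgm_rel `` {D x}" for x
  have D: "persistence_diagram (D x)" "finite (fst (D x))" if "x \<in> X" for x
    using that K M bounds unfolding D_def
    by (auto intro: persistence_diagram_spread)
  have F: "F x \<in> finite_Dgm" "F x \<in> Dgm" "D x \<in> F x" "D x \<in> Dgm_carrier" if "x \<in> X" for x
  proof -
    show "F x \<in> finite_Dgm" using D[OF that] by (auto simp: finite_Dgm_eq F_def)
    then show "F x \<in> Dgm" by (simp add: finite_Dgm_def)
    show *: "D x \<in> Dgm_carrier" using D[OF that] by (rule finite_diagram_in_Dgm_carrier)
    show "D x \<in> F x" unfolding F_def by (rule equiv_class_self[OF equiv_Dgm_rel *])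
  qed
  have eq: "bottleneck (F x) (F y) = enn2real (pre_bottleneck (D x) (D y))"
    if "x \<in> X" "y \<in> X" for x y
    using that by (intro bottleneck_class F)
  show thesis
  proof (rule that)
    show "F \<in> X \<rightarrow> finite_Dgm" using F by auto
  next
    fix x y c assume "x \<in> X" "y \<in> X" "0 \<le> c" "\<And>k. k \<in> K \<Longrightarrow> \<bar>v x k - v y k\<bar> \<le> c"
    then show "bottleneck (F x) (F y) \<le> c"
      by (auto simp: eq D_def u_h intro!: enn2real_leI pre_bottleneck_spread_le)
  next
    fix x y k assume xy: "x \<in> X" "y \<in> X" and k: "k \<in> K"
    have "ennreal \<bar>u x (h k) - u y (h k)\<bar> \<le> pre_bottleneck (D x) (D y)"
      unfolding D_def using M bounds xy k by (intro pre_bottleneck_spread_ge) auto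
    then have "enn2real (ennreal \<bar>u x (h k) - u y (h k)\<bar>) \<le> enn2real (pre_bottleneck (D x) (D y))"
      using pre_bottleneck_finite[OF F(4) F(4)] xy by (intro enn2real_mono) auto
    then show "\<bar>v x k - v y k\<bar> \<le> bottleneck (F x) (F y)"
      using xy k by (simp add: eq u_h)
  qed
qed

section \<open>Non-embeddability\<close>

text \<open>The operator inequality is applied to the averages over the toggles of each column:
  \<open>near\<close> controls its left side, \<open>far\<close> its right side. The factor
  \<open>2\<close> is the price of the words with a repetition, at most half of all words, to which
  \<open>far\<close> does not apply.\<close>

lemma enflo_inequality:
  fixes F :: "(nat \<times> nat) set \<Rightarrow> 'h :: real_inner" and k :: nat
  defines "n \<equiv> 2 ^ k"
  defines "M \<equiv> 2 * n\<^sup>2"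
  defines "\<Omega> \<equiv> {..<M} \<times> {..<n}"
  assumes near: "\<And>x z. x \<subseteq> \<Omega> \<Longrightarrow> z \<subseteq> \<Omega> \<Longrightarrow> (\<And>j. card {i. (i, j) \<in> z} \<le> 1) \<Longrightarrow>
      dist (F x) (F (sym_diff x z)) \<le> C"
    and far: "\<And>x z j. x \<subseteq> \<Omega> \<Longrightarrow> j < n \<Longrightarrow> z \<subseteq> {..<M} \<times> {j} \<Longrightarrow> card z = n \<Longrightarrow>
      D \<le> dist (F x) (F (sym_diff x z))"
    and "0 \<le> D"
  shows "D\<^sup>2 \<le> 2 * C\<^sup>2"
proof -
  define Z :: "nat \<Rightarrow> (nat \<times> nat) set list" where "Z j = map (\<lambda>i. {(i, j)}) [0..<M]" for j
  define N where "N = real (card (Pow \<Omega>))"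
  let ?ip = "l2_inner \<Omega>"
  have n: "n > 0" and M: "M > 0" by (simp_all add: n_def M_def)
  have N: "N > 0" by (simp add: N_def card_Pow \<Omega>_def)
  have Z_sub: "z \<subseteq> \<Omega>" if "j < n" "z \<in> set (Z j)" for j z
    using that by (auto simp: Z_def \<Omega>_def)
  have Z_ne: "Z j \<noteq> []" for j using M by (simp add: Z_def)

  \<comment> \<open>The entries of \<open>?R\<close> toggle one element in every column, so they are
    translations to which \<open>near\<close> applies.\<close>
  let ?R = "dyadic_conv Z k"
  have R_ne: "?R \<noteq> []" by (rule dyadic_conv_nonempty) (rule Z_ne)
  have R_sub: "z \<subseteq> \<Omega>" if "z \<in> set ?R" for z
    using Z_sub that by (rule dyadic_conv_subset) (simp_all add: n_def)
  have "2 * (?ip F F - ?ip (shift_mean ?R F) F) * real (length ?R)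
      = (\<Sum>z\<leftarrow>?R. \<Sum>x\<in>Pow \<Omega>. (dist (F x) (F (sym_diff x z)))\<^sup>2)"
    using R_sub R_ne by (intro l2_inner_shift_mean_dist) auto
  also have "\<dots> \<le> (\<Sum>z\<leftarrow>?R. N * C\<^sup>2)"
  proof (rule sum_list_mono)
    fix z assume z: "z \<in> set ?R"
    have "card {i. (i, j) \<in> z} \<le> 1" for j
      using dyadic_conv_columns[of z 0 M k j] z by (simp add: Z_def[abs_def])
    then have "dist (F x) (F (sym_diff x z)) \<le> C" if "x \<in> Pow \<Omega>" for x
      using that R_sub[OF z] by (intro near) auto
    then have "(\<Sum>x\<in>Pow \<Omega>. (dist (F x) (F (sym_diff x z)))\<^sup>2) \<le> (\<Sum>x\<in>Pow \<Omega>. C\<^sup>2)"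
      by (intro sum_mono power_mono) auto
    then show "(\<Sum>x\<in>Pow \<Omega>. (dist (F x) (F (sym_diff x z)))\<^sup>2) \<le> N * C\<^sup>2" by (simp add: N_def)
  qed
  also have "\<dots> = N * C\<^sup>2 * real (length ?R)" by (simp add: sum_list_triv)
  finally have upper: "2 * (?ip F F - ?ip (shift_mean ?R F) F) \<le> N * C\<^sup>2"
    by (rule mult_right_le_imp_le) (use R_ne in simp)

  have lower: "N * D\<^sup>2 / 2 \<le> 2 * (?ip F F - ?ip ((shift_mean (Z j) ^^ n) F) F)" if j: "j < n" for j
  proof -
    let ?W = "conv_power (Z j) n"
    have W_ne: "?W \<noteq> []" using M by (simp add: Z_def flip: length_greater_0_conv)
    have W_sub: "z \<subseteq> {..<M} \<times> {j}" if "z \<in> set ?W" for z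
      by (rule conv_power_subset[OF _ that]) (auto simp: Z_def)
    have "real M * real (length (filter (\<lambda>z. card z \<noteq> n) ?W)) \<le> real (n\<^sup>2 * M ^ n)"
      unfolding Z_def by (rule conv_power_singletons_repetitions)
    moreover have "length ?W = M ^ n" by (simp add: Z_def)
    \<comment> \<open>The choice \<open>M = 2 * n ^ 2\<close> makes the bound
      \<open>n ^ 2 / M\<close> on the share of words with a repetition equal to one half.\<close>
    ultimately have "real (n\<^sup>2) * (2 * real (length (filter (\<lambda>z. card z \<noteq> n) ?W)))
        \<le> real (n\<^sup>2) * real (length ?W)"
      by (simp add: M_def)
    then have "2 * real (length (filter (\<lambda>z. card z \<noteq> n) ?W)) \<le> real (length ?W)"
      by (rule mult_left_le_imp_le) (use n in simp)
    moreover have "length (filter (\<lambda>z. card z = n) ?W) + length (filter (\<lambda>z. card z \<noteq> n) ?W) = length ?W"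
      by (rule sum_length_filter_compl)
    ultimately have "real (length ?W) \<le> 2 * real (length (filter (\<lambda>z. card z = n) ?W))" by linarith
    then have "N * D\<^sup>2 / 2 * real (length ?W)
        \<le> N * D\<^sup>2 / 2 * (2 * real (length (filter (\<lambda>z. card z = n) ?W)))"
      using N by (intro mult_left_mono) auto
    also have "\<dots> = (\<Sum>z\<leftarrow>?W. N * D\<^sup>2 * (if card z = n then 1 else 0))"
      by (simp only: sum_list_const_mult sum_list_bool) simp
    \<comment> \<open>Words with a repetition have weight zero on the left and contribute
      nonnegative terms on the right.\<close>
    also have "\<dots> \<le> (\<Sum>z\<leftarrow>?W. \<Sum>x\<in>Pow \<Omega>. (dist (F x) (F (sym_diff x z)))\<^sup>2)"
    proof (rule sum_list_mono)
      fix z assume z: "z \<in> set ?W"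
      show "N * D\<^sup>2 * (if card z = n then 1 else 0) \<le> (\<Sum>x\<in>Pow \<Omega>. (dist (F x) (F (sym_diff x z)))\<^sup>2)"
      proof (cases "card z = n")
        case True
        have "D \<le> dist (F x) (F (sym_diff x z))" if "x \<in> Pow \<Omega>" for x
          using that j W_sub[OF z] True by (intro far) auto
        then have "(\<Sum>x\<in>Pow \<Omega>. D\<^sup>2) \<le> (\<Sum>x\<in>Pow \<Omega>. (dist (F x) (F (sym_diff x z)))\<^sup>2)"
          using \<open>0 \<le> D\<close> by (intro sum_mono power_mono) auto
        then show ?thesis using True by (simp add: N_def)
      qed (simp add: sum_nonneg)
    qed
    also have "\<dots> = 2 * (?ip F F - ?ip (shift_mean ?W F) F) * real (length ?W)"
      using W_sub W_ne j by (intro l2_inner_shift_mean_dist[symmetric]) (fastforce simp: \<Omega>_def)+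
    finally have "N * D\<^sup>2 / 2 \<le> 2 * (?ip F F - ?ip (shift_mean ?W F) F)"
      by (rule mult_right_le_imp_le) (use Z_ne in simp)
    then show ?thesis by (simp only: shift_mean_conv_power)
  qed

  \<comment> \<open>The number of columns and the length of the words are both
    \<open>n = 2 ^ k\<close>, because in the inequality the exponent equals the number of
    operators.\<close>
  have "real n * ?ip (dyadic_comp (\<lambda>j. shift_mean (Z j)) k F) F
      \<le> (\<Sum>j<2 ^ k. ?ip ((shift_mean (Z j) ^^ 2 ^ k) F) F)"
    unfolding n_def of_nat_power of_nat_numeral
  proof (rule dyadic_comp_am_gm[where ip = ?ip and B = "\<lambda>j. shift_mean (Z j)"])
    show "shift_mean (Z i) \<circ> shift_mean (Z j)
        = shift_mean (Z j) \<circ> (shift_mean (Z i) :: _ \<Rightarrow> _ \<Rightarrow> 'h)" for i j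
      by (simp add: fun_eq_iff shift_mean_commute[of "Z i" "Z j"])
    show "?ip (shift_mean (Z j) f) g = ?ip f (shift_mean (Z j) g)" if "j < 2 ^ k" for j and f g :: "_ \<Rightarrow> 'h"
      using that Z_sub by (intro l2_inner_shift_mean_self_adjoint) (auto simp: n_def)
  qed (rule l2_inner_le)
  also have "\<dots> \<le> (\<Sum>j<(2 :: nat) ^ k. ?ip F F - N * D\<^sup>2 / 4)"
  proof (rule sum_mono)
    fix j :: nat assume "j \<in> {..<2 ^ k}"
    then show "?ip ((shift_mean (Z j) ^^ 2 ^ k) F) F \<le> ?ip F F - N * D\<^sup>2 / 4"
      using lower[of j] by (simp add: n_def)
  qed
  also have "\<dots> = real n * (?ip F F - N * D\<^sup>2 / 4)" by (simp add: n_def)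
  finally have "?ip (shift_mean ?R F) F \<le> ?ip F F - N * D\<^sup>2 / 4"
    unfolding shift_mean_dyadic_conv using n by simp
  with upper have "N * D\<^sup>2 \<le> N * (2 * C\<^sup>2)" by (simp add: algebra_simps)
  then show ?thesis using N by simp
qed

lemma abs_card_diff_le:
  assumes "finite A" "finite B"
  shows "\<bar>real (card A) - real (card B)\<bar> \<le> real (card (sym_diff A B))"
proof -
  have "card A \<le> card (B \<union> sym_diff A B)" "card B \<le> card (A \<union> sym_diff A B)"
    using assms by (intro card_mono; auto)+
  then have "card A \<le> card B + card (sym_diff A B)" "card B \<le> card A + card (sym_diff A B)"
    using card_Un_le order_trans by blast+
  then show ?thesis by linarith
qed

theorem mainTheorem5:
  shows "\<not> (\<exists>f :: nat diagram set \<Rightarrow> 'h :: {real_inner, complete_space}.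
           coarse_embedding finite_Dgm bottleneck UNIV dist f)"
proof
  assume "\<exists>f :: nat diagram set \<Rightarrow> 'h. coarse_embedding finite_Dgm bottleneck UNIV dist f"
  then obtain f :: "nat diagram set \<Rightarrow> 'h" and \<rho>l \<rho>u :: "real \<Rightarrow> real" where
    mono: "mono_on {0..} \<rho>l" "mono_on {0..} \<rho>u" and
    f: "\<And>X Y. X \<in> finite_Dgm \<Longrightarrow> Y \<in> finite_Dgm \<Longrightarrow>
      \<rho>l (bottleneck X Y) \<le> dist (f X) (f Y) \<and> dist (f X) (f Y) \<le> \<rho>u (bottleneck X Y)" and
    lim: "filterlim \<rho>l at_top at_top"
    unfolding coarse_embedding_def by blast
  define C where "C = \<rho>u 1"
  \<comment> \<open>The square of this threshold exceeds \<open>2 * C ^ 2\<close>, which will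
    contradict the bound on \<open>\<rho>l (real n)\<close>.\<close>
  have "eventually (\<lambda>t. 2 * \<bar>C\<bar> + 1 \<le> \<rho>l t) at_top"
    using lim by (simp add: filterlim_at_top)
  then obtain T where T: "\<And>t. t \<ge> T \<Longrightarrow> 2 * \<bar>C\<bar> + 1 \<le> \<rho>l t"
    by (auto simp: eventually_at_top_linorder)
  obtain k :: nat where "T < 2 ^ k"
    using real_arch_pow[of 2 T] by auto
  define n :: nat where "n = 2 ^ k"
  define M where "M = 2 * n\<^sup>2"
  define \<Omega> where "\<Omega> = {..<M} \<times> {..<n}"
  have \<rho>l_n: "2 * \<bar>C\<bar> + 1 \<le> \<rho>l (real n)"
    using T[of "real n"] \<open>T < 2 ^ k\<close> by (simp add: n_def)
  \<comment> \<open>The Frechet embedding of the finite metric space: the coordinate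
    \<open>(y, j)\<close> of \<open>x\<close> is the Hamming distance from \<open>x\<close> to the
    base point \<open>y\<close> in column \<open>j\<close>.\<close>
  define v where "v x = (\<lambda>(y, j). real (card {i. (i, j) \<in> sym_diff x y}))"
    for x :: "(nat \<times> nat) set"
  have fin: "finite {i. (i, j) \<in> x}" if "x \<subseteq> \<Omega>" for x j
    by (rule finite_subset[of _ "{..<M}"]) (use that in \<open>auto simp: \<Omega>_def\<close>)
  have bounds: "0 \<le> v x p \<and> v x p \<le> real M" if "x \<in> Pow \<Omega>" "p \<in> Pow \<Omega> \<times> {..<n}" for x p
  proof -
    have "card {i. (i, snd p) \<in> sym_diff x (fst p)} \<le> card {..<M}"
      by (rule card_mono) (use that in \<open>auto simp: \<Omega>_def\<close>)
    then show ?thesis by (simp add: v_def case_prod_beta)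
  qed
  obtain F where F: "F \<in> Pow \<Omega> \<rightarrow> finite_Dgm" and
    F_le: "\<And>x y c. x \<in> Pow \<Omega> \<Longrightarrow> y \<in> Pow \<Omega> \<Longrightarrow> 0 \<le> c \<Longrightarrow>
      (\<And>p. p \<in> Pow \<Omega> \<times> {..<n} \<Longrightarrow> \<bar>v x p - v y p\<bar> \<le> c) \<Longrightarrow> bottleneck (F x) (F y) \<le> c" and
    F_ge: "\<And>x y p. x \<in> Pow \<Omega> \<Longrightarrow> y \<in> Pow \<Omega> \<Longrightarrow> p \<in> Pow \<Omega> \<times> {..<n} \<Longrightarrow>
      \<bar>v x p - v y p\<bar> \<le> bottleneck (F x) (F y)"
    by (rule finite_family_in_finite_Dgm[of "Pow \<Omega> \<times> {..<n}" "Pow \<Omega>" v "real M"])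
       (use bounds in \<open>auto simp: \<Omega>_def\<close>)
  have nonneg: "0 \<le> bottleneck X Y" for X Y by (simp add: bottleneck_def)
  have "(\<rho>l (real n))\<^sup>2 \<le> 2 * C\<^sup>2"
  proof (rule enflo_inequality[where k = k and F = "f \<circ> F"], fold n_def, fold M_def, fold \<Omega>_def)
    fix x z assume x: "x \<subseteq> \<Omega>" and z: "z \<subseteq> \<Omega>" and col: "\<And>j. card {i. (i, j) \<in> z} \<le> 1"
    have xz: "sym_diff x z \<subseteq> \<Omega>" using x z by blast
    have "bottleneck (F x) (F (sym_diff x z)) \<le> 1"
    proof (rule F_le)
      fix p assume "p \<in> Pow \<Omega> \<times> {..<n}"
      then obtain y j where p: "p = (y, j)" "y \<subseteq> \<Omega>" by auto
      \<comment> \<open>Toggling \<open>z\<close> changes a Hamming distance in column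
        \<open>j\<close> by at most the number of elements of \<open>z\<close> in that
        column.\<close>
      have "\<bar>v x p - v (sym_diff x z) p\<bar>
          \<le> real (card (sym_diff {i. (i, j) \<in> sym_diff x y} {i. (i, j) \<in> sym_diff (sym_diff x z) y}))"
        unfolding v_def p(1) case_prod_conv
        by (intro abs_card_diff_le fin) (use x z p(2) in blast)+
      also have "sym_diff {i. (i, j) \<in> sym_diff x y} {i. (i, j) \<in> sym_diff (sym_diff x z) y}
          = {i. (i, j) \<in> z}" by blast
      finally show "\<bar>v x p - v (sym_diff x z) p\<bar> \<le> 1" using col[of j] by simp
    qed (use x xz in auto)
    then have "\<rho>u (bottleneck (F x) (F (sym_diff x z))) \<le> C"
      unfolding C_def using nonneg by (intro mono_onD[OF mono(2)]) auto
    moreover have "F x \<in> finite_Dgm" "F (sym_diff x z) \<in> finite_Dgm"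
      using F x xz by (meson PiE PowI Pi_mem)+
    ultimately show "dist ((f \<circ> F) x) ((f \<circ> F) (sym_diff x z)) \<le> C"
      using f by (fastforce simp: o_def)
  next
    fix x z j assume x: "x \<subseteq> \<Omega>" and j: "j < n" and z: "z \<subseteq> {..<M} \<times> {j}" and card: "card z = n"
    have xz: "sym_diff x z \<subseteq> \<Omega>" using x z j by (auto simp: \<Omega>_def)
    have "z = {i. (i, j) \<in> z} \<times> {j}" using z by auto
    then have "card {i. (i, j) \<in> z} = n"
      using card card_cartesian_product[of "{i. (i, j) \<in> z}" "{j}"] by simp
    moreover have "{i. (i, j) \<in> sym_diff (sym_diff x z) x} = {i. (i, j) \<in> z}" by blast
    \<comment> \<open>With \<open>x\<close> itself as base point, the coordinate of \<open>x\<close>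
      is \<open>0\<close> and that of its translate is \<open>n\<close>.\<close>
    ultimately have "real n = \<bar>v x (x, j) - v (sym_diff x z) (x, j)\<bar>"
      by (simp add: v_def del: Un_iff Diff_iff)
    also have "\<dots> \<le> bottleneck (F x) (F (sym_diff x z))"
      by (rule F_ge) (use x xz j in auto)
    finally have "\<rho>l (real n) \<le> \<rho>l (bottleneck (F x) (F (sym_diff x z)))"
      using nonneg by (intro mono_onD[OF mono(1)]) auto
    moreover have "F x \<in> finite_Dgm" "F (sym_diff x z) \<in> finite_Dgm"
      using F x xz by (meson PiE PowI Pi_mem)+
    ultimately show "\<rho>l (real n) \<le> dist ((f \<circ> F) x) ((f \<circ> F) (sym_diff x z))"
      using f by (fastforce simp: o_def)
  next
    show "0 \<le> \<rho>l (real n)" using \<rho>l_n by linarith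
  qed
  moreover have "(2 * \<bar>C\<bar> + 1)\<^sup>2 \<le> (\<rho>l (real n))\<^sup>2"
    using \<rho>l_n by (intro power_mono) auto
  ultimately have "(2 * \<bar>C\<bar> + 1)\<^sup>2 \<le> 2 * \<bar>C\<bar>\<^sup>2" by simp
  moreover have "(2 * \<bar>C\<bar> + 1)\<^sup>2 = 4 * \<bar>C\<bar>\<^sup>2 + 4 * \<bar>C\<bar> + 1" by (simp add: power2_eq_square algebra_simps)
  ultimately show False using zero_le_power2[of "\<bar>C\<bar>"] by linarith
qed

end
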